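(* Let $k$ be an algebraically closed field with $\operatorname{char}(k)\neq 2$, let $n\ge1$, and assume that the subsets $\mathrm{Salg}^i_n$ ($1\le i\le n$) are closed in $\mathrm{Salg}_n$. Then $\mathrm{Salg}^1_n,\dots,\mathrm{Salg}^n_n$ are the connected components of $\mathrm{Salg}_n$.
   Context: A superalgebra is a $\mathbb{Z}_2$-graded associative unital algebra $A=A_0\oplus A_1$ over $k$; equivalently an algebra $A$ with an algebra automorphism $\sigma$ satisfying $\sigma^2=\mathrm{id}$ ($\sigma=1$ on $A_0$, $\sigma=-1$ on $A_1$). $\mathrm{Salg}_n\subseteq\mathbb{A}^{n^3+n^2}$ is the set of all $(\alpha^h_{ij},\gamma^j_i)_{1\le i,j,h\le n}$ such that $e_ie_j=\sum_h\alpha^h_{ij}e_h$ defines an associative algebra structure on $k^n$ (standard basis $e_1,\dots,e_n$) with identity $e_1$, and $\sigma(e_i)=\sum_j\gamma^j_ie_j$ defines an algebra automorphism with $\sigma^2=\mathrm{id}$. It is a Zariski closed subset of $\mathbb{A}^{n^3+n^2}$ and carries the Zariski topology. $\mathrm{Salg}^i_n$ is the subset of those points whose superalgebra $A$ satisfies $\dim A_0=i$. *)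

theory Defs
  imports
    "HOL-Analysis.Abstract_Topology_2"
    "HOL-Algebra.QuotRing"
    "HOL-Library.Poly_Mapping"
    "HOL-Library.Function_Algebras"
    "HOL-Computational_Algebra.Polynomial"
begin

section \<open>The Zariski topology on affine space\<close>

text \<open>
  A polynomial with coefficients in \<open>'k\<close> and variables in \<open>'i\<close> is a finitely supported map from
  monomials to coefficients, a monomial being a finitely supported map from variables to exponents.
\<close>

type_synonym ('i, 'k) mpolynomial = "('i \<Rightarrow>\<^sub>0 nat) \<Rightarrow>\<^sub>0 'k"

definition eval_monomial :: "('i \<Rightarrow> 'k::comm_ring_1) \<Rightarrow> ('i \<Rightarrow>\<^sub>0 nat) \<Rightarrow> 'k" where
  "eval_monomial x m = (\<Prod>i\<in>Poly_Mapping.keys m. x i ^ Poly_Mapping.lookup m i)"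

definition eval_poly :: "('i \<Rightarrow> 'k::comm_ring_1) \<Rightarrow> ('i, 'k) mpolynomial \<Rightarrow> 'k" where
  "eval_poly x p = (\<Sum>m\<in>Poly_Mapping.keys p. Poly_Mapping.lookup p m * eval_monomial x m)"

definition polys_in :: "'i set \<Rightarrow> ('i, 'k::comm_ring_1) mpolynomial set" where
  "polys_in I = {p. \<forall>m\<in>Poly_Mapping.keys p. Poly_Mapping.keys m \<subseteq> I}"

definition affine_space :: "'i set \<Rightarrow> ('i \<Rightarrow> 'k) set" where
  "affine_space I = (I \<rightarrow>\<^sub>E UNIV)"

definition zero_locus :: "'i set \<Rightarrow> ('i, 'k::comm_ring_1) mpolynomial set \<Rightarrow> ('i \<Rightarrow> 'k) set" where
  "zero_locus I P = {x \<in> affine_space I. \<forall>p\<in>P. eval_poly x p = 0}"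

definition zariski :: "'i set \<Rightarrow> ('i \<Rightarrow> 'k::field) topology" where
  "zariski I = topology (\<lambda>U. \<exists>P \<subseteq> polys_in I. U = affine_space I - zero_locus I P)"

lemma eval_monomial_superset:
  assumes "finite K" "Poly_Mapping.keys m \<subseteq> K"
  shows "eval_monomial x m = (\<Prod>i\<in>K. x i ^ Poly_Mapping.lookup m i)"
  unfolding eval_monomial_def using assms
  by (intro prod.mono_neutral_left) (auto simp: in_keys_iff)

lemma eval_monomial_add: "eval_monomial x (m + m') = eval_monomial x m * eval_monomial x m'"
proof -
  let ?K = "Poly_Mapping.keys m \<union> Poly_Mapping.keys m'"
  have "Poly_Mapping.keys (m + m') \<subseteq> ?K" by (rule keys_add)
  then show ?thesis
    by (simp add: eval_monomial_superset[of ?K] lookup_add power_add prod.distrib)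
qed

lemma eval_poly_superset:
  assumes "finite K" "Poly_Mapping.keys p \<subseteq> K"
  shows "eval_poly x p = (\<Sum>m\<in>K. Poly_Mapping.lookup p m * eval_monomial x m)"
  unfolding eval_poly_def using assms
  by (intro sum.mono_neutral_left) (auto simp: in_keys_iff)

lemma eval_poly_add: "eval_poly x (p + q) = eval_poly x p + eval_poly x q"
proof -
  let ?K = "Poly_Mapping.keys p \<union> Poly_Mapping.keys q"
  have "Poly_Mapping.keys (p + q) \<subseteq> ?K" by (rule keys_add)
  then show ?thesis
    by (simp add: eval_poly_superset[of ?K] lookup_add distrib_right sum.distrib)
qed

lemma eval_poly_zero: "eval_poly x 0 = 0"
  by (simp add: eval_poly_def)

lemma eval_poly_sum: "eval_poly x (sum f A) = (\<Sum>a\<in>A. eval_poly x (f a))"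
  by (induction A rule: infinite_finite_induct) (auto simp: eval_poly_zero eval_poly_add)

lemma eval_poly_single: "eval_poly x (Poly_Mapping.single m c) = c * eval_monomial x m"
  by (simp add: eval_poly_def)

lemma mpolynomial_expand:
  "p = (\<Sum>m\<in>Poly_Mapping.keys p. Poly_Mapping.single m (Poly_Mapping.lookup p m))"
  for p :: "('i, 'k::comm_ring_1) mpolynomial"
proof (rule poly_mapping_eqI)
  fix m
  show "Poly_Mapping.lookup p m = Poly_Mapping.lookup
      (\<Sum>m\<in>Poly_Mapping.keys p. Poly_Mapping.single m (Poly_Mapping.lookup p m)) m"
    by (simp add: lookup_sum lookup_single when_def in_keys_iff)
qed

lemma eval_poly_mult: "eval_poly x (p * q) = eval_poly x p * eval_poly x q"
proof -
  have "p * q = (\<Sum>m\<in>Poly_Mapping.keys p. Poly_Mapping.single m (Poly_Mapping.lookup p m))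
      * (\<Sum>m\<in>Poly_Mapping.keys q. Poly_Mapping.single m (Poly_Mapping.lookup q m))"
    by (rule arg_cong2[where f = "(*)"]) (rule mpolynomial_expand)+
  also have "\<dots> = (\<Sum>m\<in>Poly_Mapping.keys p. \<Sum>m'\<in>Poly_Mapping.keys q.
      Poly_Mapping.single (m + m') (Poly_Mapping.lookup p m * Poly_Mapping.lookup q m'))"
    by (simp add: sum_product mult_single)
  finally have "eval_poly x (p * q) = (\<Sum>m\<in>Poly_Mapping.keys p. \<Sum>m'\<in>Poly_Mapping.keys q.
      Poly_Mapping.lookup p m * Poly_Mapping.lookup q m' * eval_monomial x (m + m'))"
    by (simp only: eval_poly_sum eval_poly_single)
  also have "\<dots> = eval_poly x p * eval_poly x q"
    by (simp add: eval_monomial_add eval_poly_def sum_product mult_ac)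
  finally show ?thesis .
qed

lemma polys_in_mult:
  assumes "p \<in> polys_in I" "q \<in> polys_in I"
  shows "p * q \<in> polys_in I"
proof -
  have "Poly_Mapping.keys m \<subseteq> I" if m: "m \<in> Poly_Mapping.keys (p * q)" for m
  proof -
    obtain a b where "m = a + b" "a \<in> Poly_Mapping.keys p" "b \<in> Poly_Mapping.keys q"
      using m keys_mult[of p q] by blast
    then show ?thesis
      using assms keys_add[of a b] unfolding polys_in_def by blast
  qed
  then show ?thesis by (simp add: polys_in_def)
qed

lemma Int_zero_locus_compl:
  fixes P Q :: "('i, 'k::field) mpolynomial set"
  shows "(affine_space I - zero_locus I P) \<inter> (affine_space I - zero_locus I Q)
    = affine_space I - zero_locus I ((\<lambda>(p, q). p * q) ` (P \<times> Q))"
  unfolding zero_locus_def by (auto simp: eval_poly_mult)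

lemma Union_zero_locus_compl:
  "(\<Union>a\<in>A. affine_space I - zero_locus I (P a)) = affine_space I - zero_locus I (\<Union>a\<in>A. P a)"
  unfolding zero_locus_def by auto

lemma istopology_zariski:
  "istopology (\<lambda>U::('i \<Rightarrow> 'k::field) set.
    \<exists>P \<subseteq> polys_in I. U = affine_space I - zero_locus I P)" (is "istopology ?L")
  unfolding istopology_def
proof (intro conjI allI impI)
  fix S T assume "?L S" "?L T"
  then obtain P Q where P: "P \<subseteq> polys_in I" "S = affine_space I - zero_locus I P"
    and Q: "Q \<subseteq> polys_in I" "T = affine_space I - zero_locus I Q"
    by blast
  have "(\<lambda>(p, q). p * q) ` (P \<times> Q) \<subseteq> polys_in I"
    using P(1) Q(1) by (auto intro: polys_in_mult)
  then show "?L (S \<inter> T)"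
    unfolding P(2) Q(2) Int_zero_locus_compl by blast
next
  fix \<K> assume "\<forall>K\<in>\<K>. ?L K"
  then obtain P where P: "\<forall>K\<in>\<K>. P K \<subseteq> polys_in I \<and> K = affine_space I - zero_locus I (P K)"
    using bchoice[of \<K> "\<lambda>K P. P \<subseteq> polys_in I \<and> K = affine_space I - zero_locus I P"] by blast
  have sub: "(\<Union>K\<in>\<K>. P K) \<subseteq> polys_in I"
    using P by blast
  have "(\<lambda>K. affine_space I - zero_locus I (P K)) ` \<K> = id ` \<K>"
    by (rule image_cong[OF refl]) (metis P id_apply)
  then have "\<Union>\<K> = (\<Union>K\<in>\<K>. affine_space I - zero_locus I (P K))"
    by (metis image_id id_apply)
  also have "\<dots> = affine_space I - zero_locus I (\<Union>K\<in>\<K>. P K)"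
    by (rule Union_zero_locus_compl)
  finally show "?L (\<Union>\<K>)"
    using sub by (intro exI[of _ "\<Union>K\<in>\<K>. P K"] conjI)
qed

lemma openin_zariski:
  "openin (zariski I) U \<longleftrightarrow> (\<exists>P \<subseteq> polys_in I. U = affine_space I - zero_locus I P)"
  unfolding zariski_def by (subst topology_inverse'[OF istopology_zariski]) simp

lemma topspace_zariski: "topspace (zariski I :: ('i \<Rightarrow> 'k::field) topology) = affine_space I"
proof
  have "\<exists>P \<subseteq> polys_in I. topspace (zariski I :: ('i \<Rightarrow> 'k) topology) = affine_space I - zero_locus I P"
    using openin_topspace[of "zariski I :: ('i \<Rightarrow> 'k) topology"] unfolding openin_zariski .
  then show "topspace (zariski I :: ('i \<Rightarrow> 'k) topology) \<subseteq> affine_space I"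
    by blast
  have "{1} \<subseteq> (polys_in I :: ('i, 'k) mpolynomial set)"
    by (simp add: polys_in_def)
  moreover have "zero_locus I {1 :: ('i, 'k) mpolynomial} = {}"
    by (simp add: zero_locus_def eval_poly_def eval_monomial_def)
  ultimately have "openin (zariski I) (affine_space I :: ('i \<Rightarrow> 'k) set)"
    unfolding openin_zariski by (intro exI[of _ "{1}"]) simp
  then show "affine_space I \<subseteq> topspace (zariski I :: ('i \<Rightarrow> 'k) topology)"
    by (rule openin_subset)
qed

lemma closedin_zariski:
  fixes C :: "('i \<Rightarrow> 'k::field) set"
  shows "closedin (zariski I) C \<longleftrightarrow> (\<exists>P \<subseteq> polys_in I. C = zero_locus I P)"
proof -
  have *: "C = zero_locus I P \<longleftrightarrow> C \<subseteq> affine_space I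
      \<and> affine_space I - C = affine_space I - zero_locus I P"
    for P :: "('i, 'k) mpolynomial set"
    unfolding zero_locus_def by blast
  show ?thesis
    unfolding closedin_def topspace_zariski openin_zariski by (auto simp only: *)
qed


section \<open>The variety of superalgebra structures\<close>

text \<open>
  The coordinates of \<open>\<AA>\<close>-space of dimension \<open>n\<^sup>3 + n\<^sup>2\<close>: \<open>Mult i j h\<close> is the coordinate
  \<open>\<alpha>\<close> with lower indices \<open>i j\<close> and upper index \<open>h\<close>, and \<open>Autom i j\<close> is the coordinate \<open>\<gamma>\<close> with
  lower index \<open>i\<close> and upper index \<open>j\<close>. All indices run from \<open>1\<close> to \<open>n\<close>.
\<close>

datatype coordinate = Mult nat nat nat | Autom nat nat

definition coordinates :: "nat \<Rightarrow> coordinate set" where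
  "coordinates n = {Mult i j h |i j h. i \<in> {1..n} \<and> j \<in> {1..n} \<and> h \<in> {1..n}}
     \<union> {Autom i j |i j. i \<in> {1..n} \<and> j \<in> {1..n}}"

text \<open>
  The space \<open>k\<^sup>n\<close> is realised inside \<open>nat \<Rightarrow> 'k\<close> (with pointwise operations) as the functions
  that vanish outside \<open>{1..n}\<close>.
\<close>

definition coord_space :: "nat \<Rightarrow> (nat \<Rightarrow> 'k::field) set" where
  "coord_space n = {v. \<forall>i. i \<notin> {1..n} \<longrightarrow> v i = 0}"

definition std_basis :: "nat \<Rightarrow> nat \<Rightarrow> 'k::field" where
  "std_basis i = (\<lambda>j. if j = i then 1 else 0)"

definition scale_fun :: "'k::field \<Rightarrow> (nat \<Rightarrow> 'k) \<Rightarrow> nat \<Rightarrow> 'k" where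
  "scale_fun c v = (\<lambda>i. c * v i)"

interpretation fun_space: vector_space "scale_fun :: 'k::field \<Rightarrow> _"
  by unfold_locales (auto simp: scale_fun_def fun_eq_iff algebra_simps)

text \<open>
  The multiplication is the bilinear extension of the one on the standard basis, so that
  \<open>structure_algebra n x\<close> is an associative unital \<open>k\<close>-algebra with identity \<open>e\<^sub>1\<close> as soon as it is
  a ring.
\<close>

definition structure_algebra :: "nat \<Rightarrow> (coordinate \<Rightarrow> 'k::field) \<Rightarrow> (nat \<Rightarrow> 'k) ring" where
  "structure_algebra n x =
    \<lparr>carrier = coord_space n,
     monoid.mult = (\<lambda>v w h. if h \<in> {1..n}
       then \<Sum>i\<in>{1..n}. \<Sum>j\<in>{1..n}. v i * w j * x (Mult i j h) else 0),
     one = std_basis 1,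
     zero = 0,
     add = (+)\<rparr>"

definition structure_map :: "nat \<Rightarrow> (coordinate \<Rightarrow> 'k::field) \<Rightarrow> (nat \<Rightarrow> 'k) \<Rightarrow> nat \<Rightarrow> 'k" where
  "structure_map n x v = (\<lambda>j. if j \<in> {1..n} then \<Sum>i\<in>{1..n}. v i * x (Autom i j) else 0)"

definition Salg :: "nat \<Rightarrow> (coordinate \<Rightarrow> 'k::field) set" where
  "Salg n = {x \<in> affine_space (coordinates n).
     ring (structure_algebra n x) \<and>
     structure_map n x \<in> ring_iso (structure_algebra n x) (structure_algebra n x) \<and>
     (\<forall>v\<in>coord_space n. structure_map n x (structure_map n x v) = v)}"

definition even_part :: "nat \<Rightarrow> (coordinate \<Rightarrow> 'k::field) \<Rightarrow> (nat \<Rightarrow> 'k) set" where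
  "even_part n x = {v \<in> coord_space n. structure_map n x v = v}"

definition Salg_deg :: "nat \<Rightarrow> nat \<Rightarrow> (coordinate \<Rightarrow> 'k::field) set" where
  "Salg_deg n i = {x \<in> Salg n. fun_space.dim (even_part n x) = i}"

definition Salg_top :: "nat \<Rightarrow> (coordinate \<Rightarrow> 'k::field) topology" where
  "Salg_top n = subtopology (zariski (coordinates n)) (Salg n)"

end

theory Submission
  imports Defs
begin

text \<open>
  The sets \<open>Salg_deg n i\<close> are finitely many, disjoint, nonempty, closed and cover \<open>Salg n\<close>, so it
  suffices that each is connected, and for this we join points by polynomial curves
  \<open>k \<rightarrow> Salg_deg n i\<close>, whose images are irreducible. Let \<open>P = (1 + \<sigma>) / 2\<close> be the projection onto
  the even part and \<open>\<ell> v = (P v)\<^sub>1\<close>, an even functional with \<open>\<ell> e\<^sub>1 = 1\<close>. Scaling the \<open>\<sigma>\<close>-stable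
  complement \<open>ker \<ell>\<close> of \<open>k e\<^sub>1\<close> by \<open>t \<rightarrow> 0\<close> degenerates the multiplication, with \<open>\<sigma>\<close> fixed, to the
  one for which \<open>ker \<ell>\<close> has square zero. That structure depends polynomially on \<open>P\<close>, so it remains to
  join two projections of equal rank that fix \<open>e\<^sub>1\<close>. Projections with the same image, or with the same
  kernel, form an affine space; with a common complement \<open>W\<close> of the images \<open>V\<close> and \<open>V'\<close>, three
  line segments lead through the projections onto \<open>V\<close> and \<open>V'\<close> along \<open>W\<close>.
\<close>

section \<open>Connectedness\<close>

text \<open>Finiteness makes the union of the other pieces closed, so each piece is clopen. A
  component meeting a piece contains it because the piece is connected, and lies inside it because
  the piece is clopen.\<close>

lemma connected_components_of_finite_closed_partition:
  assumes fin: "finite \<U>" and Un: "\<Union>\<U> = topspace X" and disj: "pairwise disjnt \<U>"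
    and closed: "\<And>U. U \<in> \<U> \<Longrightarrow> closedin X U"
    and conn: "\<And>U. U \<in> \<U> \<Longrightarrow> connectedin X U"
    and ne: "{} \<notin> \<U>"
  shows "connected_components_of X = \<U>"
proof -
  have op: "openin X U" if U: "U \<in> \<U>" for U
  proof -
    have "closedin X (\<Union>(\<U> - {U}))"
      using fin closed by (intro closedin_Union) auto
    moreover have "topspace X - \<Union>(\<U> - {U}) = U"
      using U disj unfolding Un[symmetric] pairwise_def disjnt_def by blast
    ultimately show ?thesis
      by (metis openin_diff openin_topspace)
  qed
  have eq: "C = U" if C: "C \<in> connected_components_of X" and U: "U \<in> \<U>" and CU: "\<not> disjnt C U" for C U
  proof
    show "U \<subseteq> C"
      using connected_components_of_maximal[OF C conn[OF U] CU] .
    have "connectedin X C"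
      using C by (rule connectedin_connected_components_of)
    then show "C \<subseteq> U"
      using connectedinD[of X C U "topspace X - U"] openin_diff[OF openin_topspace closed[OF U]]
        op[OF U] CU connected_components_of_subset[OF C]
      unfolding disjnt_def by blast
  qed
  show ?thesis
  proof (intro equalityI subsetI)
    fix C assume C: "C \<in> connected_components_of X"
    then obtain x where "x \<in> C" "x \<in> topspace X"
      using nonempty_connected_components_of connected_components_of_subset by blast
    then obtain U where "U \<in> \<U>" "\<not> disjnt C U"
      unfolding Un[symmetric] disjnt_def by blast
    then show "C \<in> \<U>" using eq C by blast
  next
    fix U assume U: "U \<in> \<U>"
    then obtain x where "x \<in> U" "x \<in> \<Union>(connected_components_of X)"
      unfolding Union_connected_components_of Un[symmetric] using ne by (cases "U = {}") auto
    then obtain C where "C \<in> connected_components_of X" "\<not> disjnt C U"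
      unfolding disjnt_def by blast
    then show "U \<in> connected_components_of X" using eq U by blast
  qed
qed

text \<open>Over a finite field, 1 plus the product of all \<open>x - a\<close> would be a
  nonconstant polynomial without roots.\<close>

lemma infinite_UNIV_alg_closed: "infinite (UNIV :: 'k::alg_closed_field set)"
proof
  assume fin: "finite (UNIV :: 'k set)"
  define p where "p = (\<Prod>a\<in>(UNIV :: 'k set). [:- a, 1:]) + 1"
  have "degree (\<Prod>a\<in>(UNIV :: 'k set). [:- a, 1:]) = card (UNIV :: 'k set)"
    by (subst degree_prod_sum_eq) auto
  moreover have "card (UNIV :: 'k set) > 0"
    using fin by (simp add: card_gt_0_iff)
  ultimately have "degree p > 0"
    unfolding p_def by (simp add: degree_add_eq_left)
  then obtain x where "poly p x = 0"
    using alg_closed_imp_poly_has_root by blast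
  moreover have "poly (\<Prod>a\<in>(UNIV :: 'k set). [:- a, 1:]) x = 0"
    using fin by (auto simp: poly_prod)
  ultimately show False by (simp add: p_def)
qed

section \<open>Polynomial functions of one parameter and curves in affine space\<close>

definition polynomial_fun :: "('k::comm_ring_1 \<Rightarrow> 'k) \<Rightarrow> bool" where
  "polynomial_fun f \<longleftrightarrow> (\<exists>p. f = poly p)"

named_theorems polynomial_fun_intros

lemma polynomial_fun_const [polynomial_fun_intros]: "polynomial_fun (\<lambda>t. c)"
  unfolding polynomial_fun_def by (intro exI[of _ "[:c:]"]) auto

lemma polynomial_fun_id [polynomial_fun_intros]: "polynomial_fun (\<lambda>t. t)"
  unfolding polynomial_fun_def by (intro exI[of _ "[:0, 1:]"]) auto

lemma polynomial_fun_add [polynomial_fun_intros]: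
  "polynomial_fun f \<Longrightarrow> polynomial_fun g \<Longrightarrow> polynomial_fun (\<lambda>t. f t + g t)"
  unfolding polynomial_fun_def by (auto simp: fun_eq_iff simp flip: poly_add)

lemma polynomial_fun_diff [polynomial_fun_intros]:
  "polynomial_fun f \<Longrightarrow> polynomial_fun g \<Longrightarrow> polynomial_fun (\<lambda>t. f t - g t)"
  unfolding polynomial_fun_def by (auto simp: fun_eq_iff simp flip: poly_diff)

lemma polynomial_fun_mult [polynomial_fun_intros]:
  "polynomial_fun f \<Longrightarrow> polynomial_fun g \<Longrightarrow> polynomial_fun (\<lambda>t. f t * g t)"
  unfolding polynomial_fun_def by (auto simp: fun_eq_iff simp flip: poly_mult)

lemma polynomial_fun_power [polynomial_fun_intros]:
  "polynomial_fun f \<Longrightarrow> polynomial_fun (\<lambda>t. f t ^ d)"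
  by (induction d) (auto intro: polynomial_fun_intros)

lemma polynomial_fun_sum [polynomial_fun_intros]:
  "(\<And>a. a \<in> A \<Longrightarrow> polynomial_fun (f a)) \<Longrightarrow> polynomial_fun (\<lambda>t. \<Sum>a\<in>A. f a t)"
  by (induction A rule: infinite_finite_induct) (auto intro: polynomial_fun_intros)

lemma polynomial_fun_prod [polynomial_fun_intros]:
  "(\<And>a. a \<in> A \<Longrightarrow> polynomial_fun (f a)) \<Longrightarrow> polynomial_fun (\<lambda>t. \<Prod>a\<in>A. f a t)"
  by (induction A rule: infinite_finite_induct) (auto intro: polynomial_fun_intros)

lemma polynomial_fun_eval_poly:
  assumes "\<And>c. c \<in> I \<Longrightarrow> polynomial_fun (\<lambda>t. f t c)" and "p \<in> polys_in I"
  shows "polynomial_fun (\<lambda>t. eval_poly (f t) p)"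
  unfolding eval_poly_def eval_monomial_def
  using assms(2) by (intro polynomial_fun_intros assms(1)) (auto simp: polys_in_def)

text \<open>The image is irreducible: a closed set missing one point of the curve can only be met at
  roots of a nonzero polynomial in the parameter, and two finite sets of parameters do not exhaust
  an infinite field.\<close>

lemma connectedin_polynomial_curve:
  fixes f :: "'k::field \<Rightarrow> 'i \<Rightarrow> 'k"
  assumes inf: "infinite (UNIV :: 'k set)"
    and poly: "\<And>c. c \<in> I \<Longrightarrow> polynomial_fun (\<lambda>t. f t c)"
    and aff: "range f \<subseteq> affine_space I"
  shows "connectedin (zariski I) (range f)"
proof -
  have nonzero: "\<exists>q. q \<noteq> 0 \<and> (\<forall>t. poly q t \<noteq> 0 \<longrightarrow> f t \<notin> E)"
    if E: "closedin (zariski I) E" and t: "f t \<notin> E" for E t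
  proof -
    obtain P where P: "P \<subseteq> polys_in I" "E = zero_locus I P"
      using E unfolding closedin_zariski by blast
    have "f t \<in> affine_space I"
      using aff by blast
    then obtain p where p: "p \<in> P" "eval_poly (f t) p \<noteq> 0"
      using t P(2) by (auto simp: zero_locus_def)
    have "polynomial_fun (\<lambda>t. eval_poly (f t) p)"
      using P(1) p(1) by (intro polynomial_fun_eval_poly[OF poly]) auto
    \<comment> \<open>The witness is the restriction to the curve of an equation of \<open>E\<close>
      that fails at \<open>f t\<close>.\<close>
    then obtain q where "(\<lambda>t. eval_poly (f t) p) = poly q"
      unfolding polynomial_fun_def by blast
    then have q: "eval_poly (f s) p = poly q s" for s
      by (rule fun_cong)
    have "q \<noteq> 0" using p(2) q[of t] by auto
    moreover have "f s \<notin> E" if "poly q s \<noteq> 0" for s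
      using that p(1) P(2) by (auto simp: zero_locus_def intro!: bexI[of _ p] simp flip: q)
    ultimately show ?thesis by blast
  qed
  have False if E: "closedin (zariski I) E1" "closedin (zariski I) E2" "range f \<subseteq> E1 \<union> E2"
    and disj: "E1 \<inter> E2 \<inter> range f = {}" and ne: "E1 \<inter> range f \<noteq> {}" "E2 \<inter> range f \<noteq> {}" for E1 E2
  proof -
    \<comment> \<open>A point of the curve in one of the closed sets is outside the other, so each
      of them misses some point of the curve.\<close>
    obtain s t where "f s \<notin> E1" "f t \<notin> E2"
      using disj ne by blast
    then obtain q1 q2 where q: "q1 \<noteq> 0" "\<forall>t. poly q1 t \<noteq> 0 \<longrightarrow> f t \<notin> E1"
        "q2 \<noteq> 0" "\<forall>t. poly q2 t \<noteq> 0 \<longrightarrow> f t \<notin> E2"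
      using nonzero E by meson
    then have "finite {t. poly (q1 * q2) t = 0}"
      by (intro poly_roots_finite) simp
    then obtain u where "poly (q1 * q2) u \<noteq> 0"
      using ex_new_if_finite[OF inf] by blast
    then have "f u \<notin> E1 \<union> E2"
      using q by simp
    then show False using E(3) by blast
  qed
  then show ?thesis
    using aff unfolding connectedin_closedin topspace_zariski by blast
qed

text \<open>Lying in a common connected subset of \<open>S\<close> is an equivalence relation, so
  curves inside \<open>S\<close> can be chained and reversed.\<close>

abbreviation connected_within :: "'i set \<Rightarrow> ('i \<Rightarrow> 'k::field) set \<Rightarrow> ('i \<Rightarrow> 'k) \<Rightarrow> ('i \<Rightarrow> 'k) \<Rightarrow> bool" where
  "connected_within I S \<equiv> connected_component_of (subtopology (zariski I) S)"

lemma connected_within_polynomial_curve: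
  fixes f :: "'k::field \<Rightarrow> 'i \<Rightarrow> 'k"
  assumes "infinite (UNIV :: 'k set)" and "\<And>c. c \<in> I \<Longrightarrow> polynomial_fun (\<lambda>t. f t c)"
    and "range f \<subseteq> S" and "S \<subseteq> affine_space I"
  shows "connected_within I S (f s) (f t)"
proof -
  have "connectedin (zariski I) (range f)"
    using assms(3,4) by (intro connectedin_polynomial_curve assms(1,2)) auto
  then show ?thesis
    using assms(3) unfolding connected_component_of_def connectedin_subtopology by blast
qed

declare One_nat_def [simp del]

section \<open>Superalgebra structures on coordinate space\<close>

abbreviation linear_fun :: "((nat \<Rightarrow> 'k::field) \<Rightarrow> nat \<Rightarrow> 'k) \<Rightarrow> bool" where
  "linear_fun \<equiv> Vector_Spaces.linear scale_fun scale_fun"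

interpretation fun_space_pair: vector_space_pair "scale_fun :: 'k::field \<Rightarrow> _" "scale_fun :: 'k \<Rightarrow> _" ..

lemma linear_fun_iff:
  "linear_fun f \<longleftrightarrow> (\<forall>v w. f (v + w) = f v + f w) \<and> (\<forall>c v. f (scale_fun c v) = scale_fun c (f v))"
  by (simp add: Vector_Spaces.linear_iff fun_space.vector_space_axioms)

lemma scale_fun_apply [simp]: "scale_fun c v i = c * v i"
  by (simp add: scale_fun_def)

lemma subspace_coord_space: "fun_space.subspace (coord_space n)"
  by (auto simp: fun_space.subspace_def coord_space_def)

lemmas coord_space_closed =
  fun_space.subspace_add[OF subspace_coord_space] fun_space.subspace_diff[OF subspace_coord_space]
  fun_space.subspace_scale[OF subspace_coord_space]

lemma std_basis_in_coord_space: "i \<in> {1..n} \<Longrightarrow> std_basis i \<in> coord_space n"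
  by (auto simp: std_basis_def coord_space_def)

lemma sum_fun_apply: "(\<Sum>i\<in>A. f i) j = (\<Sum>i\<in>A. f i j)" for f :: "'a \<Rightarrow> 'b \<Rightarrow> 'c::comm_monoid_add"
  by (induction A rule: infinite_finite_induct) auto

lemma coord_space_expand:
  assumes "v \<in> coord_space n"
  shows "v = (\<Sum>i\<in>{1..n}. scale_fun (v i) (std_basis i))"
  using assms by (auto simp: fun_eq_iff sum_fun_apply std_basis_def coord_space_def if_distrib cong: if_cong)

lemma linear_fun_expand:
  assumes f: "linear_fun f" and v: "v \<in> coord_space n"
  shows "f v = (\<Sum>i\<in>{1..n}. scale_fun (v i) (f (std_basis i)))"
  by (subst coord_space_expand[OF v])
    (simp add: fun_space_pair.linear_sum[OF f] fun_space_pair.linear_scale[OF f])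

text \<open>The superalgebra axioms for maps given by formulas instead of structure constants.
  Linearity is asked on all functions, so that rules for linear maps apply directly; the algebraic
  identities concern only \<open>coord_space n\<close>. Bijectivity of \<open>\<sigma>\<close> is
  implied by \<open>aut_invol\<close>.\<close>

locale superalgebra_structure =
  fixes n :: nat and m :: "(nat \<Rightarrow> 'k::field) \<Rightarrow> (nat \<Rightarrow> 'k) \<Rightarrow> nat \<Rightarrow> 'k"
    and \<sigma> :: "(nat \<Rightarrow> 'k) \<Rightarrow> nat \<Rightarrow> 'k"
  assumes pos: "n \<ge> 1"
    and linear_left: "linear_fun (\<lambda>v. m v w)"
    and linear_right: "linear_fun (m v)"
    and linear_aut: "linear_fun \<sigma>"
    and mult_closed: "v \<in> coord_space n \<Longrightarrow> w \<in> coord_space n \<Longrightarrow> m v w \<in> coord_space n"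
    and aut_closed: "v \<in> coord_space n \<Longrightarrow> \<sigma> v \<in> coord_space n"
    and assoc: "u \<in> coord_space n \<Longrightarrow> v \<in> coord_space n \<Longrightarrow> w \<in> coord_space n
      \<Longrightarrow> m (m u v) w = m u (m v w)"
    and unit_left: "v \<in> coord_space n \<Longrightarrow> m (std_basis 1) v = v"
    and unit_right: "v \<in> coord_space n \<Longrightarrow> m v (std_basis 1) = v"
    and aut_mult: "v \<in> coord_space n \<Longrightarrow> w \<in> coord_space n \<Longrightarrow> \<sigma> (m v w) = m (\<sigma> v) (\<sigma> w)"
    and aut_unit: "\<sigma> (std_basis 1) = std_basis 1"
    and aut_invol: "v \<in> coord_space n \<Longrightarrow> \<sigma> (\<sigma> v) = v"

text \<open>The values on basis vectors give the structure constants. Off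
  \<open>coordinates n\<close> the restricted abstraction is \<open>undefined\<close>, as membership
  in \<open>affine_space\<close> demands.\<close>

definition structure_point ::
  "nat \<Rightarrow> ((nat \<Rightarrow> 'k::field) \<Rightarrow> (nat \<Rightarrow> 'k) \<Rightarrow> nat \<Rightarrow> 'k) \<Rightarrow> ((nat \<Rightarrow> 'k) \<Rightarrow> nat \<Rightarrow> 'k) \<Rightarrow> coordinate \<Rightarrow> 'k"
where
  "structure_point n m \<sigma> = (\<lambda>c\<in>coordinates n. case c of
     Mult i j h \<Rightarrow> m (std_basis i) (std_basis j) h | Autom i j \<Rightarrow> \<sigma> (std_basis i) j)"

lemma coordinates_iff [simp]:
  "Mult i j h \<in> coordinates n \<longleftrightarrow> i \<in> {1..n} \<and> j \<in> {1..n} \<and> h \<in> {1..n}"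
  "Autom i j \<in> coordinates n \<longleftrightarrow> i \<in> {1..n} \<and> j \<in> {1..n}"
  by (auto simp: coordinates_def)

lemma structure_point_in_affine_space: "structure_point n m \<sigma> \<in> affine_space (coordinates n)"
  by (auto simp: structure_point_def affine_space_def)

lemma polynomial_fun_structure_point:
  assumes "\<And>i j h. polynomial_fun (\<lambda>t. m t (std_basis i) (std_basis j) h)"
    and "\<And>i j. polynomial_fun (\<lambda>t. \<sigma> t (std_basis i) j)"
    and "c \<in> coordinates n"
  shows "polynomial_fun (\<lambda>t. structure_point n (m t) (\<sigma> t) c)"
  using assms by (cases c) (auto simp: structure_point_def)

context superalgebra_structure
begin

text \<open>By linearity it suffices that both maps agree on the basis; outside
  \<open>{1..n}\<close> both values vanish. The same argument, applied in each factor, handles the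
  multiplication below.\<close>

lemma structure_map_structure_point:
  assumes v: "v \<in> coord_space n"
  shows "structure_map n (structure_point n m \<sigma>) v = \<sigma> v"
proof
  fix j
  show "structure_map n (structure_point n m \<sigma>) v j = \<sigma> v j"
  proof (cases "j \<in> {1..n}")
    case True
    then show ?thesis
      by (subst linear_fun_expand[OF linear_aut v])
        (auto simp: structure_map_def structure_point_def sum_fun_apply intro!: sum.cong)
  next
    case False
    then show ?thesis
      using aut_closed[OF v] by (auto simp: structure_map_def coord_space_def)
  qed
qed

lemma mult_structure_point:
  assumes v: "v \<in> coord_space n" and w: "w \<in> coord_space n"
  shows "monoid.mult (structure_algebra n (structure_point n m \<sigma>)) v w = m v w"
proof
  fix h
  show "monoid.mult (structure_algebra n (structure_point n m \<sigma>)) v w h = m v w h"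
  proof (cases "h \<in> {1..n}")
    case True
    have "m v w = (\<Sum>i\<in>{1..n}. \<Sum>j\<in>{1..n}.
        scale_fun (v i) (scale_fun (w j) (m (std_basis i) (std_basis j))))"
      by (subst linear_fun_expand[OF linear_left v], subst linear_fun_expand[OF linear_right w])
        (simp only: fun_space.scale_sum_right)
    then show ?thesis
      using True
      by (auto simp: structure_algebra_def structure_point_def sum_fun_apply mult.assoc intro!: sum.cong)
  next
    case False
    then show ?thesis
      using mult_closed[OF v w] by (auto simp: structure_algebra_def coord_space_def)
  qed
qed

lemma even_part_structure_point:
  "even_part n (structure_point n m \<sigma>) = {v \<in> coord_space n. \<sigma> v = v}"
  by (auto simp: even_part_def structure_map_structure_point)

lemma structure_point_in_Salg: "structure_point n m \<sigma> \<in> Salg n"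
proof -
  let ?x = "structure_point n m \<sigma>"
  let ?A = "structure_algebra n ?x"
  have car: "carrier ?A = coord_space n" and add: "v \<oplus>\<^bsub>?A\<^esub> w = v + w"
    and zero: "\<zero>\<^bsub>?A\<^esub> = 0" and one: "\<one>\<^bsub>?A\<^esub> = std_basis 1" for v w
    by (simp_all add: structure_algebra_def)
  have one_in: "std_basis 1 \<in> coord_space n"
    using pos by (intro std_basis_in_coord_space) auto
  have zero_in: "0 \<in> coord_space n" and uminus_in: "v \<in> coord_space n \<Longrightarrow> - v \<in> coord_space n" for v
    by (auto simp: coord_space_def)
  have R: "ring ?A"
  proof (rule ringI)
    show "abelian_group ?A"
      by (rule abelian_groupI)
        (auto simp: car add zero zero_in coord_space_closed add.assoc add.commute
          intro!: bexI[OF _ uminus_in])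
    show "monoid ?A"
      by (intro monoidI)
        (auto simp: car one one_in mult_structure_point mult_closed assoc unit_left unit_right)
  qed (auto simp: car add mult_structure_point coord_space_closed
        fun_space_pair.linear_add[OF linear_left] fun_space_pair.linear_add[OF linear_right])
  have "structure_map n ?x \<in> ring_iso ?A ?A"
  proof (rule ring_iso_memI)
    show "bij_betw (structure_map n ?x) (carrier ?A) (carrier ?A)"
      by (rule bij_betwI[where g = \<sigma>])
        (auto simp: car structure_map_structure_point aut_closed aut_invol)
  qed (auto simp: car add one one_in structure_map_structure_point mult_structure_point aut_closed
      mult_closed coord_space_closed aut_mult aut_unit fun_space_pair.linear_add[OF linear_aut])
  with R show ?thesis
    by (auto simp: Salg_def structure_point_in_affine_space structure_map_structure_point
        aut_closed aut_invol)
qed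

end

text \<open>Together with \<open>structure_point_in_Salg\<close> this identifies points of the
  variety with structures. Bilinearity and closure are built into the defining sums; the other
  axioms come from the ring and its involutive automorphism.\<close>

lemma superalgebra_structure_Salg:
  assumes x: "x \<in> Salg n" and n: "n \<ge> 1"
  shows "superalgebra_structure n (monoid.mult (structure_algebra n x)) (structure_map n x)"
proof -
  let ?A = "structure_algebra n x"
  have car: "carrier ?A = coord_space n" and one: "\<one>\<^bsub>?A\<^esub> = std_basis 1"
    by (simp_all add: structure_algebra_def)
  have R: "ring ?A" and iso: "structure_map n x \<in> ring_iso ?A ?A"
    and inv: "\<forall>v\<in>coord_space n. structure_map n x (structure_map n x v) = v"
    using x by (auto simp: Salg_def)
  interpret ring ?A by (rule R)
  have hom: "structure_map n x \<in> ring_hom ?A ?A"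
    using iso by (auto simp: ring_iso_def)
  show ?thesis
  proof (rule superalgebra_structure.intro)
    show "linear_fun (\<lambda>v. monoid.mult ?A v w)" for w
      by (auto simp: linear_fun_iff structure_algebra_def fun_eq_iff sum.distrib
          sum_distrib_left distrib_left distrib_right mult_ac)
    show "linear_fun (monoid.mult ?A v)" for v
      by (auto simp: linear_fun_iff structure_algebra_def fun_eq_iff sum.distrib
          sum_distrib_left distrib_left distrib_right mult_ac)
    show "linear_fun (structure_map n x)"
      by (auto simp: linear_fun_iff structure_map_def fun_eq_iff sum.distrib
          sum_distrib_left distrib_left distrib_right mult_ac)
    show "monoid.mult ?A v w \<in> coord_space n" for v w
      by (simp add: structure_algebra_def coord_space_def)
    show "structure_map n x v \<in> coord_space n" for v
      by (simp add: structure_map_def coord_space_def)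
    show "monoid.mult ?A (monoid.mult ?A u v) w = monoid.mult ?A u (monoid.mult ?A v w)"
      if "u \<in> coord_space n" "v \<in> coord_space n" "w \<in> coord_space n" for u v w
      using that m_assoc by (simp add: car)
    show "monoid.mult ?A (std_basis 1) v = v" "monoid.mult ?A v (std_basis 1) = v" if "v \<in> coord_space n" for v
      using that l_one r_one by (simp_all add: car one)
    show "structure_map n x (monoid.mult ?A v w) = monoid.mult ?A (structure_map n x v) (structure_map n x w)"
      if "v \<in> coord_space n" "w \<in> coord_space n" for v w
      using that ring_hom_mult[OF hom] by (simp add: car)
    show "structure_map n x (std_basis 1) = std_basis 1"
      using ring_hom_one[OF hom] by (simp add: one)
  qed (use inv n in auto)
qed

lemma sum_std_basis:
  assumes "finite A" "a \<in> A"
  shows "(\<Sum>i\<in>A. std_basis a i * f i) = f a"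
  using assms by (simp add: std_basis_def if_distrib[where f = "\<lambda>c. c * _"] cong: if_cong)

text \<open>Lets an arbitrary point of \<open>Salg n\<close> serve as the end of a curve written in
  the form \<open>structure_point\<close>.\<close>

lemma structure_point_structure:
  assumes x: "x \<in> affine_space (coordinates n)"
  shows "structure_point n (monoid.mult (structure_algebra n x)) (structure_map n x) = x"
proof
  fix c
  show "structure_point n (monoid.mult (structure_algebra n x)) (structure_map n x) c = x c"
  proof (cases "c \<in> coordinates n")
    case True
    then show ?thesis
      by (cases c) (simp_all add: structure_point_def structure_algebra_def structure_map_def
          mult.assoc sum_std_basis flip: sum_distrib_left)
  next
    case False
    then show ?thesis
      using x by (simp add: structure_point_def affine_space_def PiE_def extensional_def)
  qed
qed

section \<open>Degenerating the multiplication\<close>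

text \<open>Assume \<open>l\<close> is linear with value 1 at \<open>e_1\<close>, and write
  \<open>v = l v e_1 + v_0\<close>, \<open>w = l w e_1 + w_0\<close> with \<open>v_0\<close>,
  \<open>w_0\<close> in the kernel of \<open>l\<close>. The product is
  \<open>l v l w e_1 + l v w_0 + l w v_0\<close>: \<open>e_1\<close> is the identity and the kernel
  has square zero.\<close>

definition trivial_mult ::
  "((nat \<Rightarrow> 'k::field) \<Rightarrow> 'k) \<Rightarrow> (nat \<Rightarrow> 'k) \<Rightarrow> (nat \<Rightarrow> 'k) \<Rightarrow> nat \<Rightarrow> 'k"
where
  "trivial_mult l v w = scale_fun (l v) w + scale_fun (l w) v - scale_fun (l v * l w) (std_basis 1)"

text \<open>In characteristic not 2 such \<open>P\<close> correspond to the involutions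
  \<open>\<sigma> = 2 P - 1\<close> fixing \<open>e_1\<close>, the image of \<open>P\<close> being
  the even part.\<close>

locale even_projection =
  fixes n :: nat and P :: "(nat \<Rightarrow> 'k::field) \<Rightarrow> nat \<Rightarrow> 'k"
  assumes pos: "n \<ge> 1"
    and linear: "linear_fun P"
    and closed: "v \<in> coord_space n \<Longrightarrow> P v \<in> coord_space n"
    and idem: "v \<in> coord_space n \<Longrightarrow> P (P v) = P v"
    and unit: "P (std_basis 1) = std_basis 1"
begin

lemma linear_apply:
  "P (v + w) i = P v i + P w i" "P (v - w) i = P v i - P w i" "P (scale_fun c v) i = c * P v i"
  using fun_space_pair.linear_add[OF linear] fun_space_pair.linear_diff[OF linear]
    fun_space_pair.linear_scale[OF linear] by auto

lemma unit_apply: "P (std_basis 1) 1 = 1"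
  by (subst unit) (simp add: std_basis_def)

lemma linear_parity: "linear_fun (\<lambda>v. scale_fun 2 (P v) - v)"
  by (auto simp: linear_fun_iff fun_eq_iff linear_apply algebra_simps)

lemma superalgebra_structure_trivial:
  "superalgebra_structure n (trivial_mult (\<lambda>v. P v 1)) (\<lambda>v. scale_fun 2 (P v) - v)"
proof (rule superalgebra_structure.intro)
  note simps = trivial_mult_def fun_eq_iff linear_apply unit_apply idem unit closed
  show "linear_fun (\<lambda>v. trivial_mult (\<lambda>v. P v 1) v w)" for w
    by (auto simp: linear_fun_iff simps algebra_simps)
  show "linear_fun (trivial_mult (\<lambda>v. P v 1) v)" for v
    by (auto simp: linear_fun_iff simps algebra_simps)
  show "linear_fun (\<lambda>v. scale_fun 2 (P v) - v)"
    by (rule linear_parity)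
  have one: "(std_basis 1 :: nat \<Rightarrow> 'k) \<in> coord_space n"
    using pos by (intro std_basis_in_coord_space) auto
  show "trivial_mult (\<lambda>v. P v 1) v w \<in> coord_space n"
    if "v \<in> coord_space n" "w \<in> coord_space n" for v w
    using that one unfolding trivial_mult_def by (intro coord_space_closed)
  show "scale_fun 2 (P v) - v \<in> coord_space n" if "v \<in> coord_space n" for v
    using that by (intro coord_space_closed closed)
  show "trivial_mult (\<lambda>v. P v 1) (trivial_mult (\<lambda>v. P v 1) u v) w
      = trivial_mult (\<lambda>v. P v 1) u (trivial_mult (\<lambda>v. P v 1) v w)" for u v w
    using unit_apply by (simp add: simps algebra_simps)
  show "trivial_mult (\<lambda>v. P v 1) (std_basis 1) v = v" for v
    using unit_apply by (simp add: simps algebra_simps)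
  show "trivial_mult (\<lambda>v. P v 1) v (std_basis 1) = v" for v
    using unit_apply by (simp add: simps algebra_simps)
  \<comment> \<open>The functional is invariant under the parity map, since
    \<open>P (2 P - 1) = P\<close>. As \<open>e_1\<close> is also fixed, the product built from them
    is respected.\<close>
  have val: "P (scale_fun 2 (P v) - v) 1 = P v 1" if "v \<in> coord_space n" for v
    using that by (simp add: linear_apply idem)
  show "scale_fun 2 (P (trivial_mult (\<lambda>v. P v 1) v w)) - trivial_mult (\<lambda>v. P v 1) v w
      = trivial_mult (\<lambda>v. P v 1) (scale_fun 2 (P v) - v) (scale_fun 2 (P w) - w)"
    if "v \<in> coord_space n" "w \<in> coord_space n" for v w
    using that unfolding trivial_mult_def val[OF that(1)] val[OF that(2)]
    by (simp add: fun_eq_iff linear_apply unit algebra_simps)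
  show "scale_fun 2 (P (std_basis 1)) - std_basis 1 = std_basis 1"
    by (simp add: fun_eq_iff unit)
  show "scale_fun 2 (P (scale_fun 2 (P v) - v)) - (scale_fun 2 (P v) - v) = v"
    if "v \<in> coord_space n" for v
    using that by (simp add: fun_eq_iff linear_apply idem)
qed (rule pos)

lemma fixed_points_parity:
  assumes "(2::'k) \<noteq> 0"
  shows "{v \<in> coord_space n. scale_fun 2 (P v) - v = v} = {v \<in> coord_space n. P v = v}"
proof -
  have "2 * a - b = b \<longleftrightarrow> a = b" for a b :: 'k
    using assms by (metis add_diff_cancel_right' diff_add_cancel mult_2 mult_left_cancel)
  then show ?thesis by (simp add: fun_eq_iff)
qed

end

text \<open>Its coordinates are polynomials in the entries of \<open>P\<close>, so a polynomial path
  of projections gives a polynomial curve.\<close>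

definition trivial_point :: "nat \<Rightarrow> ((nat \<Rightarrow> 'k::field) \<Rightarrow> nat \<Rightarrow> 'k) \<Rightarrow> coordinate \<Rightarrow> 'k" where
  "trivial_point n P = structure_point n (trivial_mult (\<lambda>v. P v 1)) (\<lambda>v. scale_fun 2 (P v) - v)"

lemma (in even_projection) trivial_point_in_Salg_deg:
  assumes "(2::'k) \<noteq> 0"
  shows "trivial_point n P \<in> Salg_deg n (fun_space.dim {v \<in> coord_space n. P v = v})"
proof -
  interpret superalgebra_structure n "trivial_mult (\<lambda>v. P v 1)" "\<lambda>v. scale_fun 2 (P v) - v"
    by (rule superalgebra_structure_trivial)
  show ?thesis
    using structure_point_in_Salg even_part_structure_point fixed_points_parity[OF assms]
    by (simp add: Salg_deg_def trivial_point_def)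
qed

context superalgebra_structure
begin

definition even_proj :: "(nat \<Rightarrow> 'k) \<Rightarrow> nat \<Rightarrow> 'k" where
  "even_proj v = scale_fun (1/2) (v + \<sigma> v)"

lemmas linear_simps =
  fun_space_pair.linear_add[OF linear_aut] fun_space_pair.linear_diff[OF linear_aut]
  fun_space_pair.linear_scale[OF linear_aut]
  fun_space_pair.linear_add[OF linear_left] fun_space_pair.linear_diff[OF linear_left]
  fun_space_pair.linear_scale[OF linear_left]
  fun_space_pair.linear_add[OF linear_right] fun_space_pair.linear_diff[OF linear_right]
  fun_space_pair.linear_scale[OF linear_right]

lemma one_in_coord_space: "(std_basis 1 :: nat \<Rightarrow> 'k) \<in> coord_space n"
  using pos by (intro std_basis_in_coord_space) auto

lemma even_projection_even_proj:
  assumes two: "(2::'k) \<noteq> 0"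
  shows "even_projection n even_proj"
proof (rule even_projection.intro)
  have half: "1/2 * (a + a) = a" for a :: 'k
    using two by (simp flip: mult_2)
  show "linear_fun even_proj"
    by (auto simp: linear_fun_iff even_proj_def fun_eq_iff linear_simps algebra_simps)
  show "even_proj v \<in> coord_space n" if "v \<in> coord_space n" for v
    using that unfolding even_proj_def by (intro coord_space_closed aut_closed)
  show "even_proj (even_proj v) = even_proj v" if "v \<in> coord_space n" for v
  proof -
    have "even_proj (even_proj v) = scale_fun (1/2) (even_proj v + even_proj v)"
      using that by (simp add: even_proj_def linear_simps aut_invol add.commute)
    then show ?thesis
      using half by (simp only: fun_eq_iff scale_fun_apply plus_fun_apply) simp
  qed
  show "even_proj (std_basis 1) = std_basis 1"
    using half by (simp add: even_proj_def fun_eq_iff aut_unit)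
qed (rule pos)

text \<open>
  For \<open>t \<noteq> 0\<close> this is the structure transported along the linear automorphism \<open>dilation t\<close> fixing
  \<open>e\<^sub>1\<close> and multiplying the kernel of the even functional \<open>v \<mapsto> even_proj v 1\<close> by \<open>t\<close>;
  for \<open>t = 0\<close> it is the trivial multiplication.
\<close>

definition degeneration :: "'k \<Rightarrow> (nat \<Rightarrow> 'k) \<Rightarrow> (nat \<Rightarrow> 'k) \<Rightarrow> nat \<Rightarrow> 'k" where
  "degeneration t v w =
    (let \<tau> = trivial_mult (\<lambda>v. even_proj v 1) v w; c = m v w - \<tau>
     in \<tau> + scale_fun t c + scale_fun ((t\<^sup>2 - t) * even_proj c 1) (std_basis 1))"

definition dilation :: "'k \<Rightarrow> (nat \<Rightarrow> 'k) \<Rightarrow> nat \<Rightarrow> 'k" where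
  "dilation t v = scale_fun t v + scale_fun ((1 - t) * even_proj v 1) (std_basis 1)"

text \<open>The correction \<open>c\<close> is scaled by \<open>t\<close> on the kernel of the
  functional and by \<open>t\<^sup>2\<close> along \<open>e_1\<close>; this is what transport along
  \<open>dilation t\<close> produces. For \<open>t \<noteq> 0\<close> the axioms are pulled back
  along this injective map; it may fail to be injective at \<open>t = 0\<close>, where the structure
  is the trivial one.\<close>

lemma superalgebra_structure_degeneration:
  assumes two: "(2::'k) \<noteq> 0"
  shows "superalgebra_structure n (degeneration t) \<sigma>"
proof (cases "t = 0")
  interpret P: even_projection n even_proj
    by (rule even_projection_even_proj[OF two])
  case True
  have "degeneration 0 = trivial_mult (\<lambda>v. even_proj v 1)"
    by (simp add: degeneration_def fun_eq_iff)
  moreover have "(\<lambda>v. scale_fun 2 (even_proj v) - v) = \<sigma>"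
    using two by (simp add: even_proj_def fun_eq_iff)
  ultimately show ?thesis
    using P.superalgebra_structure_trivial True by metis
next
  interpret P: even_projection n even_proj
    by (rule even_projection_even_proj[OF two])
  case False
  let ?l = "\<lambda>v. even_proj v 1"
  have one: "?l (std_basis 1) = 1"
    by (rule P.unit_apply)
  \<comment> \<open>\<open>\<sigma>\<close> only swaps the two summands of
    \<open>v + \<sigma> v\<close>.\<close>
  have l_aut: "?l (\<sigma> v) = ?l v" if "v \<in> coord_space n" for v
    using that by (simp add: even_proj_def aut_invol add.commute)
  have l_dilation: "?l (dilation t v) = ?l v" for v
    using one by (simp add: dilation_def P.linear_apply algebra_simps)
  have l_trivial: "?l (trivial_mult ?l v w) = ?l v * ?l w" for v w
    using one by (simp add: trivial_mult_def P.linear_apply)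
  have degeneration_apply: "degeneration t v w i =
      (1 - t) * (?l v * w i + ?l w * v i - ?l v * ?l w * std_basis 1 i)
      + t * m v w i + (t\<^sup>2 - t) * (?l (m v w) - ?l v * ?l w) * std_basis 1 i" for v w i
    unfolding degeneration_def Let_def P.linear_apply plus_fun_apply scale_fun_apply minus_apply l_trivial
    by (simp add: trivial_mult_def P.linear_apply left_diff_distrib right_diff_distrib)
  have l_degeneration: "?l (degeneration t v w) = ?l v * ?l w + t\<^sup>2 * (?l (m v w) - ?l v * ?l w)" for v w
    using one unfolding degeneration_def Let_def P.linear_apply l_trivial
    by (simp add: algebra_simps)
  \<comment> \<open>The image determines the functional of \<open>v\<close>, hence the multiple of
    \<open>e_1\<close> that was added; the rest is division by \<open>t\<close>.\<close>
  have inj: "v = w" if "dilation t v = dilation t w" for v w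
  proof -
    have "?l v = ?l w"
      using l_dilation that by metis
    then show ?thesis
      using that False by (simp add: dilation_def fun_eq_iff)
  qed
  have closed: "degeneration t v w \<in> coord_space n"
    if "v \<in> coord_space n" "w \<in> coord_space n" for v w
    using that one_in_coord_space unfolding degeneration_def trivial_mult_def Let_def
    by (intro coord_space_closed mult_closed)
  have dil_closed: "dilation t v \<in> coord_space n" if "v \<in> coord_space n" for v
    using that one_in_coord_space unfolding dilation_def by (intro coord_space_closed)
  have hom: "dilation t (degeneration t v w) = m (dilation t v) (dilation t w)"
    if "v \<in> coord_space n" "w \<in> coord_space n" for v w
  proof -
    \<comment> \<open>One coordinate of the claim: \<open>x\<close>, \<open>y\<close>,
      \<open>z\<close>, \<open>e\<close> stand for the \<open>i\<close>-th entries of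
      \<open>v\<close>, \<open>w\<close>, \<open>m v w\<close> and \<open>e_1\<close>, and
      \<open>a\<close>, \<open>b\<close>, \<open>c\<close> for the functional at \<open>v\<close>,
      \<open>w\<close> and \<open>m v w\<close>.\<close>
    have identity: "t\<^sup>2 * z + t * (1 - t) * b * x + t * (1 - t) * a * y + (1 - t)\<^sup>2 * a * b * e
        = t * ((1 - t) * (a * y + b * x - a * b * e) + t * z + (t\<^sup>2 - t) * (c - a * b) * e)
          + (1 - t) * (a * b + t\<^sup>2 * (c - a * b)) * e" for a b c e x y z :: 'k
      by (simp add: algebra_simps power2_eq_square)
    have "m (dilation t v) (dilation t w) = scale_fun (t\<^sup>2) (m v w)
        + scale_fun (t * (1 - t) * ?l w) v + scale_fun (t * (1 - t) * ?l v) w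
        + scale_fun ((1 - t)\<^sup>2 * ?l v * ?l w) (std_basis 1)"
      using that one_in_coord_space unfolding dilation_def linear_simps
      by (simp add: unit_left unit_right fun_eq_iff algebra_simps power2_eq_square)
    also have "\<dots> = dilation t (degeneration t v w)"
      unfolding dilation_def l_degeneration
      by (rule ext) (simp only: plus_fun_apply scale_fun_apply degeneration_apply identity)
    finally show ?thesis ..
  qed
  show ?thesis
  proof (rule superalgebra_structure.intro)
    show "linear_fun (\<lambda>v. degeneration t v w)" for w
      by (auto simp: linear_fun_iff degeneration_def trivial_mult_def Let_def fun_eq_iff linear_simps
          P.linear_apply algebra_simps)
    show "linear_fun (degeneration t v)" for v
      by (auto simp: linear_fun_iff degeneration_def trivial_mult_def Let_def fun_eq_iff linear_simps
          P.linear_apply algebra_simps)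
    show "degeneration t (degeneration t u v) w = degeneration t u (degeneration t v w)"
      if "u \<in> coord_space n" "v \<in> coord_space n" "w \<in> coord_space n" for u v w
      by (rule inj) (simp add: that hom closed assoc dil_closed)
    have dil_one: "dilation t (std_basis 1) = std_basis 1"
      using one by (simp add: dilation_def fun_eq_iff algebra_simps)
    show "degeneration t (std_basis 1) v = v" if "v \<in> coord_space n" for v
      using that one_in_coord_space dil_closed dil_one
      by - (rule inj, simp add: hom unit_left)
    show "degeneration t v (std_basis 1) = v" if "v \<in> coord_space n" for v
      using that one_in_coord_space dil_closed dil_one
      by - (rule inj, simp add: hom unit_right)
    show "\<sigma> (degeneration t v w) = degeneration t (\<sigma> v) (\<sigma> w)"
      if "v \<in> coord_space n" "w \<in> coord_space n" for v w
    proof -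
      \<comment> \<open>The coefficients of the degeneration depend on its arguments only through
        the functional at \<open>v\<close>, \<open>w\<close> and \<open>m v w\<close>, all three
        unchanged by \<open>\<sigma>\<close>.\<close>
      have "?l (m (\<sigma> v) (\<sigma> w)) = ?l (m v w)"
        using that by (metis l_aut aut_mult mult_closed)
      then show ?thesis
        using that l_aut by (simp add: degeneration_def trivial_mult_def Let_def linear_simps
            P.linear_apply aut_unit aut_mult)
    qed
  qed (use pos linear_aut aut_closed aut_unit aut_invol closed in auto)
qed

text \<open>The curve of degenerations leads from \<open>m\<close> at \<open>t = 1\<close> to the
  trivial multiplication at \<open>t = 0\<close>. As \<open>\<sigma>\<close> stays constant, so does
  the even part, and the curve remains in one stratum.\<close>

lemma connected_within_trivial_point:
  assumes two: "(2::'k) \<noteq> 0" and inf: "infinite (UNIV :: 'k set)"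
    and i: "fun_space.dim {v \<in> coord_space n. \<sigma> v = v} = i"
  shows "connected_within (coordinates n) (Salg_deg n i)
    (structure_point n m \<sigma>) (trivial_point n even_proj)"
proof -
  have "degeneration 1 = m"
    by (simp add: degeneration_def fun_eq_iff)
  moreover have "degeneration 0 = trivial_mult (\<lambda>v. even_proj v 1)"
    by (simp add: degeneration_def fun_eq_iff)
  moreover have "(\<lambda>v. scale_fun 2 (even_proj v) - v) = \<sigma>"
    using two by (simp add: even_proj_def fun_eq_iff)
  moreover have "connected_within (coordinates n) (Salg_deg n i)
      (structure_point n (degeneration 1) \<sigma>) (structure_point n (degeneration 0) \<sigma>)"
  proof (rule connected_within_polynomial_curve[OF inf])
    show "polynomial_fun (\<lambda>t. structure_point n (degeneration t) \<sigma> c)" if "c \<in> coordinates n" for c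
      using that unfolding degeneration_def Let_def
      by (intro polynomial_fun_structure_point) (auto intro!: polynomial_fun_intros)
    show "range (\<lambda>t. structure_point n (degeneration t) \<sigma>) \<subseteq> Salg_deg n i"
      using superalgebra_structure.structure_point_in_Salg[OF superalgebra_structure_degeneration[OF two]]
        superalgebra_structure.even_part_structure_point[OF superalgebra_structure_degeneration[OF two]] i
      by (auto simp: Salg_deg_def)
    show "Salg_deg n i \<subseteq> affine_space (coordinates n)"
      by (auto simp: Salg_deg_def Salg_def)
  qed
  ultimately show ?thesis
    by (simp add: trivial_point_def)
qed

end

section \<open>Moving the grading\<close>

lemma independent_std_basis: "fun_space.independent (std_basis ` {1..n} :: (nat \<Rightarrow> 'k::field) set)"
proof (rule fun_space.independent_if_scalars_zero)
  have inj: "inj_on (std_basis :: nat \<Rightarrow> nat \<Rightarrow> 'k) {1..n}"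
    by (auto simp: inj_on_def std_basis_def fun_eq_iff split: if_splits)
  fix f :: "(nat \<Rightarrow> 'k) \<Rightarrow> 'k" and x :: "nat \<Rightarrow> 'k"
  assume sum: "(\<Sum>x\<in>std_basis ` {1..n}. scale_fun (f x) x) = 0" and "x \<in> std_basis ` {1..n}"
  then obtain j where j: "j \<in> {1..n}" "x = std_basis j"
    by auto
  have "0 = (\<Sum>i\<in>{1..n}. scale_fun (f (std_basis i)) (std_basis i)) j"
    using sum by (simp add: sum.reindex[OF inj])
  also have "\<dots> = f x"
    using j by (simp add: sum_fun_apply std_basis_def if_distrib cong: if_cong)
  finally show "f x = 0" by simp
qed simp

lemma card_std_basis: "card (std_basis ` {1..n} :: (nat \<Rightarrow> 'k::field) set) = n"
proof -
  have "inj_on (std_basis :: nat \<Rightarrow> nat \<Rightarrow> 'k) {1..n}"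
    by (auto simp: inj_on_def std_basis_def fun_eq_iff split: if_splits)
  then show ?thesis by (simp add: card_image)
qed

lemma span_std_basis: "fun_space.span (std_basis ` {1..n}) = (coord_space n :: (nat \<Rightarrow> 'k::field) set)"
proof
  show "fun_space.span (std_basis ` {1..n}) \<subseteq> (coord_space n :: (nat \<Rightarrow> 'k) set)"
    by (intro fun_space.span_minimal subspace_coord_space image_subsetI std_basis_in_coord_space)
  show "(coord_space n :: (nat \<Rightarrow> 'k) set) \<subseteq> fun_space.span (std_basis ` {1..n})"
  proof
    fix v :: "nat \<Rightarrow> 'k" assume "v \<in> coord_space n"
    then have "v = (\<Sum>i\<in>{1..n}. scale_fun (v i) (std_basis i))"
      by (rule coord_space_expand)
    also have "\<dots> \<in> fun_space.span (std_basis ` {1..n})"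
      by (intro fun_space.span_sum fun_space.span_scale fun_space.span_base) auto
    finally show "v \<in> fun_space.span (std_basis ` {1..n})" .
  qed
qed

lemma dim_coord_space: "fun_space.dim (coord_space n :: (nat \<Rightarrow> 'k::field) set) = n"
  using fun_space.dim_span_eq_card_independent[OF independent_std_basis, of n]
  by (simp only: span_std_basis card_std_basis)

lemma independent_in_coord_space:
  assumes "fun_space.independent B" and "B \<subseteq> coord_space n"
  shows "finite B" and "card B \<le> n"
  using fun_space.independent_span_bound[of "std_basis ` {1..n}" B] assms
  by (auto simp only: span_std_basis card_std_basis finite_imageI finite_atLeastAtMost)

text \<open>A vector outside the span would yield \<open>n + 1\<close> independent vectors.\<close>

lemma span_eq_coord_space:
  assumes B: "fun_space.independent B" "B \<subseteq> coord_space n" and card: "card B = n"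
  shows "fun_space.span B = coord_space n"
proof
  show "fun_space.span B \<subseteq> coord_space n"
    using B(2) subspace_coord_space by (rule fun_space.span_minimal)
  show "coord_space n \<subseteq> fun_space.span B"
  proof (rule ccontr)
    assume "\<not> coord_space n \<subseteq> fun_space.span B"
    then obtain z where z: "z \<in> coord_space n" "z \<notin> fun_space.span B"
      by blast
    then have "fun_space.independent (insert z B)" "z \<notin> B"
      using B(1) by (auto simp: fun_space.independent_insert intro: fun_space.span_base)
    then show False
      using independent_in_coord_space[of "insert z B" n] independent_in_coord_space[OF B] B z card
      by simp
  qed
qed

lemma dim_coord_subspace_le:
  assumes "S \<subseteq> coord_space n"
  shows "fun_space.dim S \<le> n"
proof -
  obtain B where "B \<subseteq> S" "fun_space.independent B" "card B = fun_space.dim S"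
    using fun_space.basis_exists by metis
  then show ?thesis
    using independent_in_coord_space(2)[of B n] assms by auto
qed

lemma dim_coord_subspace_pos:
  assumes S: "S \<subseteq> coord_space n" and v: "v \<in> S" "v \<noteq> 0"
  shows "fun_space.dim S \<ge> 1"
proof -
  obtain B where B: "B \<subseteq> S" "fun_space.independent B" "S \<subseteq> fun_space.span B" "card B = fun_space.dim S"
    using fun_space.basis_exists by metis
  \<comment> \<open>Finiteness is essential here: an infinite basis would have
    \<open>card B = 0\<close>.\<close>
  then have "finite B"
    using independent_in_coord_space(1)[of B n] S by auto
  moreover have "B \<noteq> {}"
    using B(3) v by auto
  ultimately show ?thesis
    using B(4) by (metis One_nat_def Suc_leI card_gt_0_iff)
qed

text \<open>
  A space is not the union of two proper subspaces, so a set independent of both \<open>A\<close> and \<open>B\<close> can be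
  enlarged as long as it does not complete them to bases.
\<close>

lemma common_complement:
  fixes A B :: "(nat \<Rightarrow> 'k::field) set"
  assumes A: "fun_space.independent A" "A \<subseteq> coord_space n"
    and B: "fun_space.independent B" "B \<subseteq> coord_space n" and card: "card A = card B"
  obtains W where "A \<inter> W = {}" "fun_space.independent (A \<union> W)" "fun_space.span (A \<union> W) = coord_space n"
    "B \<inter> W = {}" "fun_space.independent (B \<union> W)" "fun_space.span (B \<union> W) = coord_space n"
proof -
  define good where "good W \<longleftrightarrow> W \<subseteq> coord_space n \<and> A \<inter> W = {} \<and> fun_space.independent (A \<union> W)
    \<and> B \<inter> W = {} \<and> fun_space.independent (B \<union> W)" for W
  have bound: "finite W \<and> card W \<le> n" if "good W" for W
    using independent_in_coord_space[of W n] fun_space.independent_mono[of "A \<union> W" W] that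
    by (auto simp: good_def)
  \<comment> \<open>A largest admissible \<open>W\<close> exists because independent sets have at
    most \<open>n\<close> elements; maximality will force it to complete both sets to bases.\<close>
  have "\<exists>W. good W \<and> (\<forall>W'. good W' \<longrightarrow> card W' \<le> card W)"
  proof (rule ex_has_greatest_nat[of good "{}" card "Suc n"])
    show "good {}"
      using A B by (simp add: good_def)
    show "\<forall>W. good W \<longrightarrow> card W < Suc n"
      using bound by (simp add: less_Suc_eq_le)
  qed
  then obtain W where W: "good W" and max: "\<And>W'. good W' \<Longrightarrow> card W' \<le> card W"
    by blast
  have finW: "finite W" and finA: "finite A" and finB: "finite B"
    using bound[OF W] independent_in_coord_space[OF A] independent_in_coord_space[OF B] by auto
  have indA: "fun_space.independent (A \<union> W)" "A \<union> W \<subseteq> coord_space n"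
    and indB: "fun_space.independent (B \<union> W)" "B \<union> W \<subseteq> coord_space n"
    using W A B by (auto simp: good_def)
  have cardA: "card (A \<union> W) = card A + card W" and cardB: "card (B \<union> W) = card A + card W"
    using W finW finA finB card by (auto simp: good_def card_Un_disjoint)
  have "card A + card W = n"
  proof (rule ccontr)
    assume "card A + card W \<noteq> n"
    then have ne: "coord_space n \<noteq> fun_space.span (A \<union> W)" "coord_space n \<noteq> fun_space.span (B \<union> W)"
      using fun_space.dim_span_eq_card_independent[OF indA(1)]
        fun_space.dim_span_eq_card_independent[OF indB(1)] dim_coord_space[of n, where 'k='k] cardA cardB
      by metis+
    have sub: "fun_space.span (A \<union> W) \<subseteq> coord_space n" "fun_space.span (B \<union> W) \<subseteq> coord_space n"
      using indA(2) indB(2) by (simp_all add: fun_space.span_minimal subspace_coord_space)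
    obtain a b where a: "a \<in> coord_space n" "a \<notin> fun_space.span (A \<union> W)"
      and b: "b \<in> coord_space n" "b \<notin> fun_space.span (B \<union> W)"
      using ne sub by blast
    obtain z where z: "z \<in> coord_space n" "z \<notin> fun_space.span (A \<union> W)" "z \<notin> fun_space.span (B \<union> W)"
    \<comment> \<open>If each of \<open>a\<close>, \<open>b\<close> lies in the span the other one
      avoids, their sum avoids both; otherwise one of them already does.\<close>
    proof (cases "a \<in> fun_space.span (B \<union> W) \<and> b \<in> fun_space.span (A \<union> W)")
      case True
      then have "a + b \<notin> fun_space.span (A \<union> W)" "a + b \<notin> fun_space.span (B \<union> W)"
        using a b by (metis fun_space.span_add_eq fun_space.span_add_eq2)+
      then show ?thesis
        using that a b coord_space_closed(1) by blast
    qed (use that a b in blast)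
    have "good (insert z W)"
      using W z by (auto simp: good_def fun_space.independent_insert intro: fun_space.span_base)
    then have "card (insert z W) \<le> card W"
      by (rule max)
    moreover have "z \<notin> W"
      using z by (auto intro: fun_space.span_base)
    ultimately show False
      using finW by simp
  qed
  then have "fun_space.span (A \<union> W) = coord_space n" "fun_space.span (B \<union> W) = coord_space n"
    using span_eq_coord_space[OF indA] span_eq_coord_space[OF indB] cardA cardB by simp_all
  then show ?thesis
    using that W by (auto simp: good_def)
qed

text \<open>The identity on \<open>B\<close> and zero on \<open>W\<close> extend linearly to the
  projection onto the span of \<open>B\<close> along the span of \<open>W\<close>. It fixes
  \<open>e_1\<close> because \<open>e_1\<close> lies in the span of \<open>B\<close>.\<close>

lemma projection_with_complement:
  assumes B: "fun_space.independent (B \<union> W)" "fun_space.span (B \<union> W) = coord_space n" "B \<inter> W = {}"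
    and one: "std_basis 1 \<in> fun_space.span B" and n: "n \<ge> 1"
  obtains P where "even_projection n P" "\<And>v. v \<in> fun_space.span B \<Longrightarrow> P v = v"
    "\<And>v. v \<in> coord_space n \<Longrightarrow> P v \<in> fun_space.span B"
    "\<And>v. v \<in> coord_space n \<Longrightarrow> v - P v \<in> fun_space.span W"
    "\<And>v. v \<in> fun_space.span W \<Longrightarrow> P v = 0"
proof -
  define P where "P = fun_space_pair.construct (B \<union> W) (\<lambda>b. if b \<in> B then b else 0)"
  have lin: "linear_fun P"
    unfolding P_def by (rule fun_space_pair.linear_construct[OF B(1)])
  have basis: "P b = (if b \<in> B then b else 0)" if "b \<in> B \<union> W" for b
    unfolding P_def using that by (rule fun_space_pair.construct_basis[OF B(1)])
  have fix_B: "P v = v" if "v \<in> fun_space.span B" for v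
    using fun_space_pair.linear_eq_on[OF lin fun_space.linear_id that] basis by auto
  have kill_W: "P v = 0" if "v \<in> fun_space.span W" for v
    by (rule fun_space_pair.linear_eq_0_on_span[OF lin _ that]) (use basis B(3) in auto)
  have decomp: "P v \<in> fun_space.span B \<and> v - P v \<in> fun_space.span W" if v: "v \<in> coord_space n" for v
  proof -
    obtain b w where bw: "b \<in> fun_space.span B" "w \<in> fun_space.span W" "v = b + w"
      using v unfolding B(2)[symmetric] fun_space.span_Un by blast
    then have "P v = b"
      using fix_B kill_W fun_space_pair.linear_add[OF lin] by simp
    then show ?thesis using bw by simp
  qed
  have sub: "fun_space.span B \<subseteq> coord_space n"
    unfolding B(2)[symmetric] by (rule fun_space.span_mono) auto
  have "even_projection n P"
    by (rule even_projection.intro) (use n lin decomp sub fix_B one in auto)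
  then show ?thesis
    using that fix_B decomp kill_W by blast
qed

section \<open>Line segments between projections\<close>

lemma linear_fun_affine_combination:
  assumes "linear_fun P" and "linear_fun Q"
  shows "linear_fun (\<lambda>v. scale_fun (1 - t) (P v) + scale_fun t (Q v))"
  using assms by (auto simp: linear_fun_iff fun_eq_iff algebra_simps)

text \<open>The relations \<open>P Q = P\<close> and \<open>Q P = Q\<close> say that the kernels
  agree. Then \<open>Q\<close> maps the image of \<open>P\<close> bijectively onto the image of
  \<open>Q\<close>, with inverse \<open>P\<close>, and carries a basis to a basis.\<close>

lemma dim_fixed_points_eq:
  assumes P: "even_projection n P" and Q: "even_projection n Q"
    and PQ: "\<And>v. v \<in> coord_space n \<Longrightarrow> P (Q v) = P v"
    and QP: "\<And>v. v \<in> coord_space n \<Longrightarrow> Q (P v) = Q v"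
  shows "fun_space.dim {v \<in> coord_space n. P v = v} = fun_space.dim {v \<in> coord_space n. Q v = v}"
proof -
  interpret P: even_projection n P by (rule P)
  interpret Q: even_projection n Q by (rule Q)
  let ?F = "{v \<in> coord_space n. P v = v}" and ?G = "{v \<in> coord_space n. Q v = v}"
  obtain B where B: "B \<subseteq> ?F" "fun_space.independent B" "?F \<subseteq> fun_space.span B" "card B = fun_space.dim ?F"
    by (rule fun_space.basis_exists)
  have "fun_space.subspace ?F"
    using subspace_coord_space[of n] fun_space_pair.linear_0[OF P.linear]
      fun_space_pair.linear_add[OF P.linear] fun_space_pair.linear_scale[OF P.linear]
    by (auto simp: fun_space.subspace_def)
  then have span: "fun_space.span B = ?F"
    using B by (metis fun_space.span_minimal subset_antisym)
  have inj: "inj_on Q ?F"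
  proof (rule inj_onI)
    fix v w assume vw: "v \<in> ?F" "w \<in> ?F" "Q v = Q w"
    have "P (Q v) = v" "P (Q w) = w"
      using PQ[of v] PQ[of w] vw(1,2) by simp_all
    then show "v = w"
      using vw(3) by argo
  qed
  have image: "Q ` ?F = ?G"
  proof (intro equalityI subsetI)
    fix w assume "w \<in> ?G"
    then show "w \<in> Q ` ?F"
      using QP[of w] by (intro image_eqI[of _ _ "P w"]) (auto simp: P.closed P.idem)
  qed (auto simp: Q.closed Q.idem)
  have "fun_space.independent (Q ` B)"
    using fun_space_pair.linear_independent_injective_image[OF Q.linear B(2)] inj span by simp
  moreover have "fun_space.span (Q ` B) = ?G"
    using fun_space_pair.linear_span_image[OF Q.linear] span image by simp
  ultimately have "fun_space.dim ?G = card (Q ` B)"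
    using fun_space.dim_span_eq_card_independent by metis
  also have "\<dots> = card B"
    using inj B(1) by (intro card_image) (rule inj_on_subset)
  finally show ?thesis using B(4) by simp
qed

text \<open>The segment is affine in \<open>t\<close>, so the trivial points along it have
  coordinates of degree at most 2 in \<open>t\<close>. The assumptions on all \<open>t\<close> keep
  this curve in the stratum.\<close>

lemma connected_within_trivial_points:
  fixes P Q :: "(nat \<Rightarrow> 'k::field) \<Rightarrow> nat \<Rightarrow> 'k"
  assumes two: "(2::'k) \<noteq> 0" and inf: "infinite (UNIV :: 'k set)"
    and P: "even_projection n P" and Q: "even_projection n Q"
    and proj: "\<And>t. even_projection n (\<lambda>v. scale_fun (1 - t) (P v) + scale_fun t (Q v))"
    and dim: "\<And>t. fun_space.dim
      {v \<in> coord_space n. scale_fun (1 - t) (P v) + scale_fun t (Q v) = v} = i"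
  shows "connected_within (coordinates n) (Salg_deg n i) (trivial_point n P) (trivial_point n Q)"
proof -
  let ?R = "\<lambda>t v. scale_fun (1 - t) (P v) + scale_fun t (Q v)"
  have "connected_within (coordinates n) (Salg_deg n i) (trivial_point n (?R 0)) (trivial_point n (?R 1))"
  proof (rule connected_within_polynomial_curve[OF inf])
    show "polynomial_fun (\<lambda>t. trivial_point n (?R t) c)" if "c \<in> coordinates n" for c
      using that unfolding trivial_point_def trivial_mult_def
      by (intro polynomial_fun_structure_point) (auto intro!: polynomial_fun_intros)
    show "range (\<lambda>t. trivial_point n (?R t)) \<subseteq> Salg_deg n i"
      using even_projection.trivial_point_in_Salg_deg[OF proj two] dim by auto
    show "Salg_deg n i \<subseteq> affine_space (coordinates n)"
      by (auto simp: Salg_deg_def Salg_def)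
  qed
  moreover have "?R 0 = P" "?R 1 = Q"
    by (auto simp: fun_eq_iff)
  ultimately show ?thesis by metis
qed

text \<open>Here \<open>P Q = Q\<close> and \<open>Q P = P\<close> express equality of images. A
  combination \<open>R\<close> takes values in this image and fixes it pointwise, so it is a
  projection with the same fixed space.\<close>

lemma connected_within_same_image:
  fixes P Q :: "(nat \<Rightarrow> 'k::field) \<Rightarrow> nat \<Rightarrow> 'k"
  assumes two: "(2::'k) \<noteq> 0" and inf: "infinite (UNIV :: 'k set)"
    and P: "even_projection n P" and Q: "even_projection n Q"
    and PQ: "\<And>v. v \<in> coord_space n \<Longrightarrow> P (Q v) = Q v"
    and QP: "\<And>v. v \<in> coord_space n \<Longrightarrow> Q (P v) = P v"
    and i: "fun_space.dim {v \<in> coord_space n. P v = v} = i"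
  shows "connected_within (coordinates n) (Salg_deg n i) (trivial_point n P) (trivial_point n Q)"
proof (rule connected_within_trivial_points[OF two inf P Q])
  interpret P: even_projection n P by (rule P)
  interpret Q: even_projection n Q by (rule Q)
  fix t
  let ?R = "\<lambda>v. scale_fun (1 - t) (P v) + scale_fun t (Q v)"
  have PR: "P (?R v) = ?R v" if "v \<in> coord_space n" for v
    using that by (simp add: fun_eq_iff P.linear_apply P.idem PQ)
  have R: "?R v = v" if "P v = v" "v \<in> coord_space n" for v
  proof -
    have "Q v = v"
      using that QP[of v] by simp
    then show ?thesis
      using that(1) by (simp add: fun_eq_iff algebra_simps)
  qed
  have closed: "?R v \<in> coord_space n" if "v \<in> coord_space n" for v
    using that by (intro coord_space_closed P.closed Q.closed)
  show "even_projection n ?R"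
  proof (rule even_projection.intro)
    show "linear_fun ?R"
      by (rule linear_fun_affine_combination[OF P.linear Q.linear])
    show "?R (?R v) = ?R v" if "v \<in> coord_space n" for v
      using R[OF PR closed] that by simp
    show "?R (std_basis 1) = std_basis 1"
      by (simp add: P.unit Q.unit fun_eq_iff algebra_simps)
  qed (use P.pos closed in auto)
  have "{v \<in> coord_space n. ?R v = v} = {v \<in> coord_space n. P v = v}"
    using PR R by (metis (mono_tags, lifting))
  then show "fun_space.dim {v \<in> coord_space n. ?R v = v} = i"
    using i by simp
qed

text \<open>Equality of kernels gives \<open>P R = P\<close> and \<open>Q R = Q\<close> for a
  combination \<open>R\<close>, hence \<open>R R = R\<close>. The fixed space may move with
  \<open>t\<close>, but \<open>R P = R\<close> shows that the kernel does not, so the dimension is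
  constant.\<close>

lemma connected_within_same_kernel:
  fixes P Q :: "(nat \<Rightarrow> 'k::field) \<Rightarrow> nat \<Rightarrow> 'k"
  assumes two: "(2::'k) \<noteq> 0" and inf: "infinite (UNIV :: 'k set)"
    and P: "even_projection n P" and Q: "even_projection n Q"
    and PQ: "\<And>v. v \<in> coord_space n \<Longrightarrow> P (Q v) = P v"
    and QP: "\<And>v. v \<in> coord_space n \<Longrightarrow> Q (P v) = Q v"
    and i: "fun_space.dim {v \<in> coord_space n. P v = v} = i"
  shows "connected_within (coordinates n) (Salg_deg n i) (trivial_point n P) (trivial_point n Q)"
proof (rule connected_within_trivial_points[OF two inf P Q])
  interpret P: even_projection n P by (rule P)
  interpret Q: even_projection n Q by (rule Q)
  fix t
  let ?R = "\<lambda>v. scale_fun (1 - t) (P v) + scale_fun t (Q v)"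
  have PR: "P (?R v) = P v" and QR: "Q (?R v) = Q v" if "v \<in> coord_space n" for v
    using that by (simp_all add: fun_eq_iff P.linear_apply Q.linear_apply P.idem Q.idem PQ QP algebra_simps)
  have RP: "?R (P v) = ?R v" if "v \<in> coord_space n" for v
    using that by (simp add: P.idem QP)
  have closed: "?R v \<in> coord_space n" if "v \<in> coord_space n" for v
    using that by (intro coord_space_closed P.closed Q.closed)
  show R: "even_projection n ?R"
  proof (rule even_projection.intro)
    show "linear_fun ?R"
      by (rule linear_fun_affine_combination[OF P.linear Q.linear])
    show "?R (?R v) = ?R v" if "v \<in> coord_space n" for v
      using PR QR that by simp
    show "?R (std_basis 1) = std_basis 1"
      by (simp add: P.unit Q.unit fun_eq_iff algebra_simps)
  qed (use P.pos closed in auto)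
  show "fun_space.dim {v \<in> coord_space n. ?R v = v} = i"
    by (rule trans[OF dim_fixed_points_eq[OF P R PR RP, symmetric] i])
qed

text \<open>The route is \<open>P\<close>, \<open>P'\<close>, \<open>Q'\<close>, \<open>Q\<close>,
  where \<open>P'\<close> and \<open>Q'\<close> project onto the images of \<open>P\<close> and
  \<open>Q\<close> along a common complement. The outer segments keep the image, the middle one
  keeps the kernel.\<close>

lemma connected_within_trivial_points_same_dim:
  fixes P Q :: "(nat \<Rightarrow> 'k::field) \<Rightarrow> nat \<Rightarrow> 'k"
  assumes two: "(2::'k) \<noteq> 0" and inf: "infinite (UNIV :: 'k set)"
    and P: "even_projection n P" and Q: "even_projection n Q"
    and dimP: "fun_space.dim {v \<in> coord_space n. P v = v} = i"
    and dimQ: "fun_space.dim {v \<in> coord_space n. Q v = v} = i"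
  shows "connected_within (coordinates n) (Salg_deg n i) (trivial_point n P) (trivial_point n Q)"
proof -
  interpret P: even_projection n P by (rule P)
  interpret Q: even_projection n Q by (rule Q)
  let ?F = "{v \<in> coord_space n. P v = v}" and ?G = "{v \<in> coord_space n. Q v = v}"
  obtain A where A: "A \<subseteq> ?F" "fun_space.independent A" "?F \<subseteq> fun_space.span A" "card A = fun_space.dim ?F"
    by (rule fun_space.basis_exists)
  obtain B where B: "B \<subseteq> ?G" "fun_space.independent B" "?G \<subseteq> fun_space.span B" "card B = fun_space.dim ?G"
    by (rule fun_space.basis_exists)
  obtain W where WA: "A \<inter> W = {}" "fun_space.independent (A \<union> W)" "fun_space.span (A \<union> W) = coord_space n"
    and WB: "B \<inter> W = {}" "fun_space.independent (B \<union> W)" "fun_space.span (B \<union> W) = coord_space n"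
  proof (rule common_complement)
    show "A \<subseteq> coord_space n" "B \<subseteq> coord_space n"
      using A(1) B(1) by auto
    show "card A = card B"
      using A(4) B(4) dimP dimQ by simp
  qed (use A(2) B(2) in auto)
  have fixA: "P v = v" if "v \<in> fun_space.span A" for v
    using fun_space_pair.linear_eq_on[OF P.linear fun_space.linear_id that] A(1) by auto
  have fixB: "Q v = v" if "v \<in> fun_space.span B" for v
    using fun_space_pair.linear_eq_on[OF Q.linear fun_space.linear_id that] B(1) by auto
  have "std_basis 1 \<in> ?F" "std_basis 1 \<in> ?G"
    using P.unit Q.unit std_basis_in_coord_space[of 1 n] P.pos by auto
  then have one: "std_basis 1 \<in> fun_space.span A" "std_basis 1 \<in> fun_space.span B"
    using A(3) B(3) by auto
  obtain P' where P': "even_projection n P'" "\<And>v. v \<in> fun_space.span A \<Longrightarrow> P' v = v"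
    "\<And>v. v \<in> coord_space n \<Longrightarrow> P' v \<in> fun_space.span A"
    "\<And>v. v \<in> coord_space n \<Longrightarrow> v - P' v \<in> fun_space.span W"
    "\<And>v. v \<in> fun_space.span W \<Longrightarrow> P' v = 0"
    using projection_with_complement[OF WA(2,3,1) one(1) P.pos] by blast
  obtain Q' where Q': "even_projection n Q'" "\<And>v. v \<in> fun_space.span B \<Longrightarrow> Q' v = v"
    "\<And>v. v \<in> coord_space n \<Longrightarrow> Q' v \<in> fun_space.span B"
    "\<And>v. v \<in> coord_space n \<Longrightarrow> v - Q' v \<in> fun_space.span W"
    "\<And>v. v \<in> fun_space.span W \<Longrightarrow> Q' v = 0"
    using projection_with_complement[OF WB(2,3,1) one(2) P.pos] by blast
  interpret P': even_projection n P' by (rule P'(1))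
  interpret Q': even_projection n Q' by (rule Q'(1))
  have F: "P v \<in> fun_space.span A" if "v \<in> coord_space n" for v
    using that A(3) P.closed P.idem by blast
  have G: "Q v \<in> fun_space.span B" if "v \<in> coord_space n" for v
    using that B(3) Q.closed Q.idem by blast
  have dimP': "fun_space.dim {v \<in> coord_space n. P' v = v} = i"
  proof -
    have "{v \<in> coord_space n. P' v = v} = ?F"
      using P'(2,3) fixA F by (metis (mono_tags, lifting))
    then show ?thesis using dimP by simp
  qed
  have "connected_within (coordinates n) (Salg_deg n i) (trivial_point n P) (trivial_point n P')"
    using P'(2,3) fixA F by (intro connected_within_same_image[OF two inf P P'(1) _ _ dimP]) auto
  moreover have "connected_within (coordinates n) (Salg_deg n i) (trivial_point n P') (trivial_point n Q')"
  proof (rule connected_within_same_kernel[OF two inf P'(1) Q'(1) _ _ dimP'])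
    fix v :: "nat \<Rightarrow> 'k" assume v: "v \<in> coord_space n"
    \<comment> \<open>Both differences lie in the span of \<open>W\<close>, which \<open>P'\<close>
      and \<open>Q'\<close> both annihilate.\<close>
    have "P' (v - Q' v) = 0" "Q' (v - P' v) = 0"
      using v P'(4,5) Q'(4,5) by auto
    then show "P' (Q' v) = P' v" "Q' (P' v) = Q' v"
      by (auto simp: fun_space_pair.linear_diff[OF P'.linear] fun_space_pair.linear_diff[OF Q'.linear])
  qed
  moreover have "connected_within (coordinates n) (Salg_deg n i) (trivial_point n Q) (trivial_point n Q')"
    using Q'(2,3) fixB G by (intro connected_within_same_image[OF two inf Q Q'(1) _ _ dimQ]) auto
  ultimately show ?thesis
    by (meson connected_component_of_sym connected_component_of_trans)
qed

section \<open>The strata are connected, nonempty and cover the variety\<close>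

lemma connectedin_Salg_deg:
  assumes two: "(2::'k::field) \<noteq> 0" and inf: "infinite (UNIV :: 'k set)" and n: "n \<ge> 1"
  shows "connectedin (Salg_top n) (Salg_deg n i :: (coordinate \<Rightarrow> 'k) set)"
proof -
  let ?C = "connected_within (coordinates n) (Salg_deg n i :: (coordinate \<Rightarrow> 'k) set)"
  have sub: "Salg_deg n i \<subseteq> Salg n" "Salg n \<subseteq> affine_space (coordinates n)"
    by (auto simp: Salg_deg_def Salg_def)
  \<comment> \<open>Every point degenerates, inside its stratum, to the trivial structure on its own
    even projection, whose rank is \<open>i\<close>.\<close>
  have to_trivial: "\<exists>P. even_projection n P \<and> fun_space.dim {v \<in> coord_space n. P v = v} = i
      \<and> ?C x (trivial_point n P)" if x: "x \<in> Salg_deg n i" for x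
  proof -
    interpret superalgebra_structure n "monoid.mult (structure_algebra n x)" "structure_map n x"
      using x n by (intro superalgebra_structure_Salg) (auto simp: Salg_deg_def)
    interpret P: even_projection n even_proj
      by (rule even_projection_even_proj[OF two])
    have dim: "fun_space.dim {v \<in> coord_space n. structure_map n x v = v} = i"
      using x by (simp add: Salg_deg_def even_part_def)
    have "(\<lambda>v. scale_fun 2 (even_proj v) - v) = structure_map n x"
      using two by (simp add: even_proj_def fun_eq_iff)
    then have "fun_space.dim {v \<in> coord_space n. even_proj v = v} = i"
      using P.fixed_points_parity[OF two] dim by (simp add: fun_eq_iff)
    moreover have "?C x (trivial_point n even_proj)"
      using connected_within_trivial_point[OF two inf dim] structure_point_structure[of x n] x sub
      by auto
    ultimately show ?thesis
      using P.even_projection_axioms by blast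
  qed
  have "?C x y" if xy: "x \<in> Salg_deg n i" "y \<in> Salg_deg n i" for x y
  proof -
    obtain P Q where "even_projection n P" "fun_space.dim {v \<in> coord_space n. P v = v} = i"
        "?C x (trivial_point n P)"
        "even_projection n Q" "fun_space.dim {v \<in> coord_space n. Q v = v} = i"
        "?C y (trivial_point n Q)"
      using to_trivial xy by meson
    then show ?thesis
      using connected_within_trivial_points_same_dim[OF two inf, of n P Q i]
      by (meson connected_component_of_sym connected_component_of_trans)
  qed
  then have "connected_space (subtopology (zariski (coordinates n)) (Salg_deg n i :: (coordinate \<Rightarrow> 'k) set))"
    unfolding connected_space_iff_connected_component by simp
  then have "connectedin (zariski (coordinates n)) (Salg_deg n i :: (coordinate \<Rightarrow> 'k) set)"
    using sub unfolding connectedin_def topspace_zariski by blast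
  then show ?thesis
    using sub by (simp add: Salg_top_def connectedin_subtopology)
qed

lemma Salg_deg_nonempty:
  assumes two: "(2::'k::field) \<noteq> 0" and i: "i \<in> {1..n}"
  shows "(Salg_deg n i :: (coordinate \<Rightarrow> 'k) set) \<noteq> {}"
proof -
  \<comment> \<open>Truncation to the first \<open>i\<close> coordinates has fixed space
    \<open>coord_space i\<close>; it fixes \<open>e_1\<close> because
    \<open>i \<ge> 1\<close>.\<close>
  define P :: "(nat \<Rightarrow> 'k) \<Rightarrow> nat \<Rightarrow> 'k" where "P v = (\<lambda>j. if j \<in> {1..i} then v j else 0)" for v
  have "even_projection n P"
    by (rule even_projection.intro)
      (use i in \<open>auto simp: P_def linear_fun_iff fun_eq_iff coord_space_def std_basis_def\<close>)
  moreover have "{v \<in> coord_space n. P v = v} = coord_space i"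
    using i by (auto simp: P_def coord_space_def fun_eq_iff)
  ultimately show ?thesis
    using even_projection.trivial_point_in_Salg_deg[OF _ two] dim_coord_space[of i, where 'k='k] by fastforce
qed

text \<open>The degree 0 does not occur: an automorphism fixes the identity, so \<open>e_1\<close>
  is a nonzero even vector.\<close>

lemma Salg_eq_Union_Salg_deg:
  assumes "n \<ge> 1"
  shows "(Salg n :: (coordinate \<Rightarrow> 'k::field) set) = (\<Union>i\<in>{1..n}. Salg_deg n i)"
proof -
  have "fun_space.dim (even_part n x) \<in> {1..n}" if x: "x \<in> Salg n" for x :: "coordinate \<Rightarrow> 'k"
  proof -
    interpret superalgebra_structure n "monoid.mult (structure_algebra n x)" "structure_map n x"
      using x assms by (rule superalgebra_structure_Salg)
    have sub: "even_part n x \<subseteq> coord_space n"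
      by (auto simp: even_part_def)
    have one: "std_basis 1 \<in> even_part n x"
      using one_in_coord_space aut_unit by (simp add: even_part_def)
    have "(std_basis 1 :: nat \<Rightarrow> 'k) \<noteq> 0"
      by (auto simp: std_basis_def fun_eq_iff)
    then show ?thesis
      using dim_coord_subspace_pos[OF sub one] dim_coord_subspace_le[OF sub] by simp
  qed
  then show ?thesis
    by (auto simp: Salg_deg_def)
qed

theorem proposition4p5:
  fixes n :: nat
  assumes "CHAR('k::alg_closed_field) \<noteq> 2"
    and "n \<ge> 1"
    and "\<And>i. i \<in> {1..n} \<Longrightarrow> closedin (Salg_top n) (Salg_deg n i :: (coordinate \<Rightarrow> 'k) set)"
  shows "connected_components_of (Salg_top n :: (coordinate \<Rightarrow> 'k) topology) = Salg_deg n ` {1..n}"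
proof (rule connected_components_of_finite_closed_partition)
  \<comment> \<open>A characteristic dividing 2 and different from 2 would be 1, forcing
    \<open>1 = 0\<close> in the field.\<close>
  have "(of_nat 2 :: 'k) \<noteq> 0"
  proof
    assume "(of_nat 2 :: 'k) = 0"
    then have "CHAR('k) dvd 2"
      by (simp only: of_nat_eq_0_iff_char_dvd)
    then have "CHAR('k) = 1"
      using assms(1) two_is_prime_nat by (auto simp: prime_nat_iff)
    then show False
      using of_nat_CHAR[where 'a = 'k] by simp
  qed
  then have two: "(2::'k) \<noteq> 0"
    by simp
  show "connectedin (Salg_top n) U" if "U \<in> Salg_deg n ` {1..n}" for U :: "(coordinate \<Rightarrow> 'k) set"
    using that connectedin_Salg_deg[OF two infinite_UNIV_alg_closed assms(2)] by blast
  show "{} \<notin> (Salg_deg n ` {1..n} :: (coordinate \<Rightarrow> 'k) set set)"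
    using Salg_deg_nonempty[OF two] by fastforce
  have "Salg n \<subseteq> (topspace (zariski (coordinates n)) :: (coordinate \<Rightarrow> 'k) set)"
    by (auto simp: topspace_zariski Salg_def)
  then show "\<Union>(Salg_deg n ` {1..n}) = topspace (Salg_top n :: (coordinate \<Rightarrow> 'k) topology)"
    using Salg_eq_Union_Salg_deg[OF assms(2), where 'k='k] by (simp add: Salg_top_def Int_absorb1)
  show "pairwise disjnt (Salg_deg n ` {1..n} :: (coordinate \<Rightarrow> 'k) set set)"
    by (auto simp: pairwise_def disjnt_def Salg_deg_def)
qed (use assms(3) in auto)

end
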